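(* Let $\Gamma$ be a metrized graph with an optimal vertex set $V(\Gamma)$ of $v$ vertices and edge set $E(\Gamma)$, discrete Laplacian $\mathrm{L}=(l_{pq})$ and pseudo inverse $\mathrm{L}^+=(l^+_{pq})$, and let $p_i,q_i$ be the endpoints of $e_i\in E(\Gamma)$. Then for any $p\in V(\Gamma)$, $$\sum_{e_i\in E(\Gamma)}\frac{L_i\big(R_{b_i,p}-R_{a_i,p}\big)^2}{(L_i+R_i)^2}=\frac4v\mathrm{tr}(\mathrm{L}^+)-\frac12\sum_{q,s\in V(\Gamma)} l_{qs}\big(l^+_{qq}-l^+_{ss}\big)^2.$$
   Context: A metrized graph is a finite connected graph whose edges $e_i$ are identified with closed segments of lengths $L_i>0$. A vertex set $V(\Gamma)$ (finite, containing all points of valence $\neq2$, possibly some valence-2 points) is optimal if with respect to it there are no self-loops and no two edges joining the same pair of vertices. Fix an ordering of $V(\Gamma)$. The discrete Laplacian $\mathrm{L}=(l_{pq})$: for $p\neq q$, $l_{pq}=-1/L_k$ if $p,q$ are joined by an edge of length $L_k$ and $0$ otherwise; $l_{pp}=-\sum_{s\neq p}l_{ps}$. $\mathrm{L}^+$ is its Moore–Penrose pseudo inverse. View $\Gamma$ as an electric circuit with each edge of resistance equal to its length. $\Gamma-e_i$ is the graph obtained by deleting the interior of $e_i$, and $R_i$ is the effective resistance between $p_i$ and $q_i$ in $\Gamma-e_i$. If $\Gamma-e_i$ is connected, let $\hat j_z(x,y)$ be the voltage function of $\Gamma-e_i$ (voltage at $x$ when unit current enters at $y$ and exits at $z$,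 voltage $0$ at $z$) and set $R_{a_i,p}=\hat j_{p_i}(p,q_i)$, $R_{b_i,p}=\hat j_{q_i}(p_i,p)$ (so $R_{a_i,p}+R_{b_i,p}=R_i$). If $\Gamma-e_i$ is disconnected, $R_i=\infty$, and $R_{a_i,p}=0,R_{b_i,p}=\infty$ if $p$ is in the component containing $p_i$, while $R_{a_i,p}=\infty,R_{b_i,p}=0$ if $p$ is in the component containing $q_i$; the corresponding summand is then interpreted as its limit $L_i$. *)

theory Defs
  imports
    "HOL-Analysis.Analysis"
    "HOL-Real_Asymp.Real_Asymp"
    "Graph_Theory.Graph_Theory"
begin

text \<open>
  A metrized graph together with a vertex set is presented by its combinatorial model: vertices,
  edges, and a positive length for each edge.  Every point in the interior of an edge has valence 2,
  so the vertex set automatically contains all points of valence other than 2.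

  The arcs of the digraph are the edges of the (undirected) metrized graph, each listed once.  The
  orientation only serves to name the two end points of an edge \<open>e\<close>: \<open>tail G e\<close> is $p_i$
  and \<open>head G e\<close> is $q_i$.  Loops and multiple edges are allowed here and are excluded only by
  \<open>optimal_vertex_set\<close>.  The vertices fill a finite type, so that matrices indexed by the
  vertices are elements of \<open>real ^ 'v ^ 'v\<close>.
\<close>

locale metrized_graph = fin_digraph G
  for G :: "('v::finite, 'e) pre_digraph" +
  fixes len :: "'e \<Rightarrow> real"
  assumes verts_UNIV: "verts G = UNIV"
    and connected: "Digraph_Component.connected G"
    and len_pos: "e \<in> arcs G \<Longrightarrow> 0 < len e"

definition joins :: "('v, 'e) pre_digraph \<Rightarrow> 'e \<Rightarrow> 'v \<Rightarrow> 'v \<Rightarrow> bool" where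
  "joins G e p q \<longleftrightarrow> e \<in> arcs G \<and> {tail G e, head G e} = {p, q}"

definition optimal_vertex_set :: "('v, 'e) pre_digraph \<Rightarrow> bool" where
  "optimal_vertex_set G \<longleftrightarrow>
     (\<forall>e p. \<not> joins G e p p) \<and>
     (\<forall>e e' p q. joins G e p q \<and> joins G e' p q \<longrightarrow> e = e')"

text \<open>The description \<open>THE e\<close> below is proper only for an optimal vertex set.\<close>

definition laplacian_offdiag :: "('v, 'e) pre_digraph \<Rightarrow> ('e \<Rightarrow> real) \<Rightarrow> 'v \<Rightarrow> 'v \<Rightarrow> real" where
  "laplacian_offdiag G len p q =
     (if \<exists>e. joins G e p q then - 1 / len (THE e. joins G e p q) else 0)"

definition discrete_laplacian ::
    "('v::finite, 'e) pre_digraph \<Rightarrow> ('e \<Rightarrow> real) \<Rightarrow> real ^ 'v ^ 'v" where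
  "discrete_laplacian G len =
     (\<chi> p q. if p = q then - (\<Sum>s\<in>UNIV - {p}. laplacian_offdiag G len p s)
             else laplacian_offdiag G len p q)"

definition is_pseudo_inverse :: "real ^ 'n ^ 'm \<Rightarrow> real ^ 'm ^ 'n \<Rightarrow> bool" where
  "is_pseudo_inverse A X \<longleftrightarrow>
     A ** X ** A = A \<and> X ** A ** X = X \<and>
     transpose (A ** X) = A ** X \<and> transpose (X ** A) = X ** A"

definition pseudo_inverse :: "real ^ 'n ^ 'm \<Rightarrow> real ^ 'm ^ 'n" where
  "pseudo_inverse A = (THE X. is_pseudo_inverse A X)"

text \<open>
  Net current flowing out of the vertex \<open>x\<close> along the edges of the circuit when the potential
  is \<open>f\<close> and each edge has resistance equal to its length (Ohm's law).
\<close>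

definition net_outflow ::
    "('v, 'e) pre_digraph \<Rightarrow> ('e \<Rightarrow> real) \<Rightarrow> ('v \<Rightarrow> real) \<Rightarrow> 'v \<Rightarrow> real" where
  "net_outflow G len f x =
     (\<Sum>e | e \<in> arcs G \<and> tail G e = x. (f x - f (head G e)) / len e) +
     (\<Sum>e | e \<in> arcs G \<and> head G e = x. (f x - f (tail G e)) / len e)"

text \<open>
  \<open>voltage G len z x y\<close> is $j_z(x,y)$: the potential at \<open>x\<close>, normalised to vanish at
  \<open>z\<close>, when unit current enters at \<open>y\<close> and exits at \<open>z\<close> (Kirchhoff's current law).
  The description is proper when \<open>G\<close> is connected.
\<close>

definition is_voltage_function ::
    "('v, 'e) pre_digraph \<Rightarrow> ('e \<Rightarrow> real) \<Rightarrow> 'v \<Rightarrow> 'v \<Rightarrow> ('v \<Rightarrow> real) \<Rightarrow> bool" where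
  "is_voltage_function G len z y f \<longleftrightarrow>
     f z = 0 \<and> (\<forall>x. net_outflow G len f x = of_bool (x = y) - of_bool (x = z))"

definition voltage :: "('v, 'e) pre_digraph \<Rightarrow> ('e \<Rightarrow> real) \<Rightarrow> 'v \<Rightarrow> 'v \<Rightarrow> 'v \<Rightarrow> real" where
  "voltage G len z x y = (THE f. is_voltage_function G len z y f) x"

definition effective_resistance ::
    "('v, 'e) pre_digraph \<Rightarrow> ('e \<Rightarrow> real) \<Rightarrow> 'v \<Rightarrow> 'v \<Rightarrow> real" where
  "effective_resistance G len p q = voltage G len q p p"

definition same_component :: "('v, 'e) pre_digraph \<Rightarrow> 'v \<Rightarrow> 'v \<Rightarrow> bool" where
  "same_component G p q \<longleftrightarrow> p \<rightarrow>\<^sup>*\<^bsub>with_proj (mk_symmetric G)\<^esub> q"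

text \<open>The quantities $R_i$, $R_{a_i,p}$ and $R_{b_i,p}$, all taken in $\Gamma - e_i$.\<close>

definition edge_R :: "('v, 'e) pre_digraph \<Rightarrow> ('e \<Rightarrow> real) \<Rightarrow> 'e \<Rightarrow> ereal" where
  "edge_R G len e =
     (let H = pre_digraph.del_arc G e in
      if Digraph_Component.connected H
      then ereal (effective_resistance H len (tail G e) (head G e))
      else \<infinity>)"

definition edge_Ra :: "('v, 'e) pre_digraph \<Rightarrow> ('e \<Rightarrow> real) \<Rightarrow> 'e \<Rightarrow> 'v \<Rightarrow> ereal" where
  "edge_Ra G len e p =
     (let H = pre_digraph.del_arc G e in
      if Digraph_Component.connected H then ereal (voltage H len (tail G e) p (head G e))
      else if same_component H p (tail G e) then 0
      else \<infinity>)"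

definition edge_Rb :: "('v, 'e) pre_digraph \<Rightarrow> ('e \<Rightarrow> real) \<Rightarrow> 'e \<Rightarrow> 'v \<Rightarrow> ereal" where
  "edge_Rb G len e p =
     (let H = pre_digraph.del_arc G e in
      if Digraph_Component.connected H then ereal (voltage H len (head G e) (tail G e) p)
      else if same_component H p (tail G e) then \<infinity>
      else 0)"

text \<open>
  The summand at \<open>e\<close>.  For $R_i = \infty$ the quotient is indeterminate and is read as its
  limit, which is the length of \<open>e\<close> (see the lemma below; one of $R_{a_i,p}$, $R_{b_i,p}$ is
  then 0 and the other tends to infinity together with $R_i$).
\<close>

definition edge_term :: "('v, 'e) pre_digraph \<Rightarrow> ('e \<Rightarrow> real) \<Rightarrow> 'v \<Rightarrow> 'e \<Rightarrow> real" where
  "edge_term G len p e =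
     (if edge_R G len e = \<infinity> then len e
      else len e * (real_of_ereal (edge_Rb G len e p) - real_of_ereal (edge_Ra G len e p))\<^sup>2
             / (len e + real_of_ereal (edge_R G len e))\<^sup>2)"

lemma edge_term_limit:
  fixes l :: real
  shows "((\<lambda>r. l * (r - 0)\<^sup>2 / (l + r)\<^sup>2) \<longlongrightarrow> l) at_top"
    and "((\<lambda>r. l * (0 - r)\<^sup>2 / (l + r)\<^sup>2) \<longlongrightarrow> l) at_top"
  by real_asymp+

end

theory Submission
  imports Defs
begin

text \<open>
  Write $Q = \mathrm{L}^+$.  Deleting the edge $e$ with end points $a, b$ rescales the potential
  $h = Q_{\cdot a} - Q_{\cdot b}$ of the dipole at $a, b$ by the factor $1 + R/L$, and comparing
  potentials gives $L (R_b - R_a) / (L + R) = 2 h(p) - h(a) - h(b)$.  If $e$ is a bridge, $h$ takes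
  only two values, which differ by $L$, so the right-hand side is $\pm L$.  In terms of
  $D(x) = 2 Q_{px} - Q_{xx}$ it equals $D(a) - D(b)$, so the sum over the edges is the Dirichlet
  energy $D^T \mathrm{L} D$, which is expanded using
  $\mathrm{L} Q = I - J/v$, where $J$ is the all-ones matrix.
\<close>

section \<open>Moore--Penrose pseudo inverses\<close>

lemma matrix_matrix_mult_add_rdistrib:
  fixes A B :: "'a::semiring_1 ^ 'n ^ 'm"
  shows "(A + B) ** C = A ** C + B ** C"
  by (simp add: matrix_matrix_mult_def vec_eq_iff distrib_right sum.distrib)

lemma matrix_matrix_mult_diff_rdistrib:
  fixes A B :: "'a::ring_1 ^ 'n ^ 'm"
  shows "(A - B) ** C = A ** C - B ** C"
  by (simp add: matrix_matrix_mult_def vec_eq_iff left_diff_distrib sum_subtractf)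

lemma matrix_matrix_mult_diff_ldistrib:
  fixes B C :: "'a::ring_1 ^ 'n ^ 'm"
  shows "A ** (B - C) = A ** B - A ** C"
  by (simp add: matrix_matrix_mult_def vec_eq_iff right_diff_distrib sum_subtractf)

text \<open>The symmetry conditions let factors be swapped, so two pseudo inverses give the same
  products \<open>A ** X\<close> and \<open>X ** A\<close>; then \<open>X ** A ** X\<close> and
  \<open>Y ** A ** Y\<close> agree.\<close>

lemma is_pseudo_inverse_unique:
  fixes A :: "real ^ 'n ^ 'm"
  assumes X: "is_pseudo_inverse A X" and Y: "is_pseudo_inverse A Y"
  shows "X = Y"
proof -
  have XA: "A ** X ** A = A" "X ** A ** X = X" "transpose (A ** X) = A ** X"
      "transpose (X ** A) = X ** A"
    and YA: "A ** Y ** A = A" "Y ** A ** Y = Y" "transpose (A ** Y) = A ** Y"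
      "transpose (Y ** A) = Y ** A"
    using X Y by (simp_all add: is_pseudo_inverse_def)
  have "A ** X = transpose ((A ** Y) ** (A ** X))"
    using XA YA by (simp add: matrix_mul_assoc)
  also have "\<dots> = (A ** X) ** (A ** Y)"
    using XA YA by (simp add: matrix_transpose_mul)
  also have "\<dots> = A ** Y"
    using XA by (simp add: matrix_mul_assoc)
  finally have AX: "A ** X = A ** Y" .
  have "X ** A = transpose ((X ** A) ** (Y ** A))"
    using XA YA by (metis matrix_mul_assoc)
  also have "\<dots> = (Y ** A) ** (X ** A)"
    using XA YA by (simp add: matrix_transpose_mul)
  also have "\<dots> = Y ** A"
    using XA by (metis matrix_mul_assoc)
  finally have "X ** A = Y ** A" .
  then show ?thesis
    using XA(2) YA(2) AX by (metis matrix_mul_assoc)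
qed

lemma pseudo_inverse_eqI:
  "is_pseudo_inverse A X \<Longrightarrow> pseudo_inverse A = X"
  unfolding pseudo_inverse_def by (blast intro: is_pseudo_inverse_unique)

text \<open>\<open>K\<close> is the orthogonal projection onto the constants, which form the kernel
  of \<open>A\<close>. Hence \<open>A + K\<close> is invertible, and the pseudo inverse is its
  inverse minus \<open>K\<close>.\<close>

lemma pseudo_inverse_kernel_constants:
  fixes A :: "real ^ 'n ^ 'n" and K :: "real ^ 'n ^ 'n"
  defines "K \<equiv> (\<chi> i j. 1 / real CARD('n))"
  assumes sym: "transpose A = A"
    and ker: "\<And>x. A *v x = 0 \<longleftrightarrow> (\<forall>i j. x $ i = x $ j)"
  shows "A ** pseudo_inverse A = mat 1 - K"
    and "pseudo_inverse A ** A = mat 1 - K"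
    and "pseudo_inverse A ** K = 0"
    and "transpose (pseudo_inverse A) = pseudo_inverse A"
proof -
  have Kv: "K *v x = (\<chi> i. (\<Sum>j\<in>UNIV. x $ j) / real CARD('n))" for x
    by (simp add: K_def vec_eq_iff matrix_vector_mult_def sum_divide_distrib)
  have KT: "transpose K = K"
    by (simp add: K_def transpose_def vec_eq_iff)
  have KK: "K ** K = K"
    by (simp add: K_def matrix_matrix_mult_def vec_eq_iff)
  have AK: "A ** K = 0"
  proof -
    have "A *v (K *v x) = 0" for x
      by (subst ker) (simp add: Kv)
    then show ?thesis
      by (simp add: matrix_eq flip: matrix_vector_mul_assoc)
  qed
  have KA: "K ** A = 0"
    using arg_cong[OF AK, of transpose] sym KT
    by (simp add: matrix_transpose_mul) (simp add: transpose_def vec_eq_iff)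
  \<comment> \<open>Applying \<open>K\<close> shows that \<open>x\<close> has mean zero; what
    remains puts \<open>x\<close> into the kernel of \<open>A\<close>, so \<open>x\<close> is
    constant as well.\<close>
  have "x = 0" if "(A + K) *v x = 0" for x
  proof -
    have "K *v ((A + K) *v x) = K *v x"
      by (simp add: matrix_vector_mul_assoc matrix_add_ldistrib KA KK)
    then have Kx: "K *v x = 0"
      using that by simp
    then have "A *v x = 0"
      using that by (simp add: matrix_vector_mult_add_rdistrib)
    then have const: "x $ i = x $ j" for i j
      by (simp add: ker)
    have "x $ i = 0" for i
    proof -
      have "(\<Sum>j\<in>UNIV. x $ j) = real CARD('n) * x $ i"
        by (subst const[of _ i]) simp
      then show ?thesis
        using Kx by (simp add: Kv vec_eq_iff)
    qed
    then show ?thesis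
      by (simp add: vec_eq_iff)
  qed
  then obtain B where BA: "B ** (A + K) = mat 1"
    using matrix_left_invertible_ker by blast
  then have AB: "(A + K) ** B = mat 1"
    by (simp add: matrix_left_right_inverse)
  have "transpose (A + K) = A + K"
    using sym KT by (simp add: transpose_def vec_eq_iff)
  then have "transpose B ** (A + K) = mat 1"
    using arg_cong[OF AB, of transpose] by (simp add: matrix_transpose_mul transpose_mat)
  then have BT: "transpose B = B"
    using AB by (metis matrix_mul_assoc matrix_mul_lid matrix_mul_rid)
  have "(A + K) ** K = K"
    by (simp add: matrix_matrix_mult_add_rdistrib AK KK)
  then have BK: "B ** K = K"
    using BA by (metis matrix_mul_assoc matrix_mul_lid)
  have KB: "K ** B = K"
    using arg_cong[OF BK, of transpose] BT KT by (simp add: matrix_transpose_mul)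
  \<comment> \<open>\<open>B\<close> fixes the constants because \<open>A + K\<close> does;
    subtracting \<open>K\<close> makes \<open>X\<close> kill them.\<close>
  define X where "X = B - K"
  have AX: "A ** X = mat 1 - K"
  proof -
    have "A ** X = A ** B"
      by (simp add: X_def matrix_matrix_mult_diff_ldistrib AK)
    also have "\<dots> = (A + K) ** B - K ** B"
      by (simp add: matrix_matrix_mult_add_rdistrib)
    finally show ?thesis
      by (simp add: AB KB)
  qed
  have XA: "X ** A = mat 1 - K"
  proof -
    have "X ** A = B ** A"
      by (simp add: X_def matrix_matrix_mult_diff_rdistrib KA)
    also have "\<dots> = B ** (A + K) - B ** K"
      by (simp add: matrix_add_ldistrib)
    finally show ?thesis
      by (simp add: BA BK)
  qed
  have XK: "X ** K = 0"
    by (simp add: X_def matrix_matrix_mult_diff_rdistrib BK KK)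
  have KX: "K ** X = 0"
    by (simp add: X_def matrix_matrix_mult_diff_ldistrib KB KK)
  have IT: "transpose (mat 1 - K) = mat 1 - K"
    using KT by (simp add: transpose_def vec_eq_iff mat_def)
  have "is_pseudo_inverse A X"
    unfolding is_pseudo_inverse_def AX XA IT
    by (simp add: matrix_matrix_mult_diff_rdistrib KA KX)
  then have X: "pseudo_inverse A = X"
    by (rule pseudo_inverse_eqI)
  have XT: "transpose X = X"
    using BT KT by (simp add: X_def transpose_def vec_eq_iff)
  show "A ** pseudo_inverse A = mat 1 - K" "pseudo_inverse A ** A = mat 1 - K"
    "pseudo_inverse A ** K = 0" "transpose (pseudo_inverse A) = pseudo_inverse A"
    by (simp_all add: X AX XA XK XT)
qed

section \<open>Currents in a graph\<close>

lemma connected_iff_same_component: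
  assumes "verts G = UNIV"
  shows "Digraph_Component.connected G \<longleftrightarrow> (\<forall>u v. same_component G u v)"
  using assms by (simp add: connected_def strongly_connected_def same_component_def)

lemma same_component_sym:
  "same_component G u v \<Longrightarrow> same_component G v u"
  unfolding same_component_def by (rule symmetric_reachable[OF symmetric_mk_symmetric])

lemma same_component_trans:
  assumes "same_component G u v" "same_component G v w"
  shows "same_component G u w"
  using assms unfolding same_component_def reachable_def by (rule rtrancl_on_trans)

lemma same_component_refl:
  "verts G = UNIV \<Longrightarrow> same_component G u u"
  by (simp add: same_component_def reachable_def)

lemma same_component_arc:
  assumes "verts G = UNIV" "e \<in> arcs G"
  shows "same_component G (tail G e) (head G e)"
  unfolding same_component_def reachable_def
  using assms
  by (intro rtrancl_on_into_rtrancl_on[OF rtrancl_on_refl])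
     (force simp: arcs_ends_conv parcs_mk_symmetric)+

text \<open>Used to pass from equality across single edges, as given by vanishing energy, to
  constancy on components.\<close>

lemma same_component_invariant:
  assumes "same_component G u v"
    and "\<And>e. e \<in> arcs G \<Longrightarrow> f (tail G e) = f (head G e)"
  shows "f u = f v"
  using assms(1) unfolding same_component_def reachable_def
proof (induction rule: rtrancl_on_induct)
  case (step y z)
  then show ?case
    using assms(2) by (auto simp: parcs_mk_symmetric)
qed simp

section \<open>Net outflow, Dirichlet energy and deletion of an edge\<close>

lemma net_outflow_scale:
  "net_outflow G len (\<lambda>x. c * f x) x = c * net_outflow G len f x"
  by (simp add: net_outflow_def sum_distrib_left distrib_left right_diff_distrib)

lemma net_outflow_diff:
  "net_outflow G len (\<lambda>x. f x - g x) x = net_outflow G len f x - net_outflow G len g x"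
proof -
  have *: "(f x - g x - (f y - g y)) / l = (f x - f y) / l - (g x - g y) / l" for y and l :: real
    by (simp add: diff_divide_distrib)
  show ?thesis
    unfolding net_outflow_def * sum_subtractf by simp
qed

text \<open>Summation by parts: the current in an edge is counted at its tail and, with opposite
  sign, at its head. The right-hand side is symmetric in \<open>f\<close> and \<open>g\<close>, so
  the net outflow is self-adjoint; \<open>g = f\<close> gives the Dirichlet energy.\<close>

lemma energy_eq:
  fixes G :: "('v::finite, 'e) pre_digraph"
  assumes "finite (arcs G)"
  shows "(\<Sum>x\<in>UNIV. g x * net_outflow G len f x) =
    (\<Sum>e\<in>arcs G. (g (tail G e) - g (head G e)) * (f (tail G e) - f (head G e)) / len e)"
proof -
  have *: "(\<Sum>x\<in>UNIV. \<Sum>e | e \<in> arcs G \<and> t e = x. F e) = (\<Sum>e\<in>arcs G. F e)"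
    for t :: "'e \<Rightarrow> 'v" and F :: "'e \<Rightarrow> real"
    using sum.group[of "arcs G" UNIV t F] assms by simp
  have "(\<Sum>x\<in>UNIV. g x * net_outflow G len f x) =
      (\<Sum>x\<in>UNIV. \<Sum>e | e \<in> arcs G \<and> tail G e = x.
        g (tail G e) * ((f (tail G e) - f (head G e)) / len e)) +
      (\<Sum>x\<in>UNIV. \<Sum>e | e \<in> arcs G \<and> head G e = x.
        g (head G e) * ((f (head G e) - f (tail G e)) / len e))"
    unfolding net_outflow_def distrib_left sum_distrib_left sum.distrib
    by (intro arg_cong2[where f = "(+)"] sum.cong refl) auto
  also have "\<dots> = (\<Sum>e\<in>arcs G. g (tail G e) * ((f (tail G e) - f (head G e)) / len e) +
      g (head G e) * ((f (head G e) - f (tail G e)) / len e))"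
    by (simp only: * sum.distrib)
  also have "\<dots> = (\<Sum>e\<in>arcs G.
      (g (tail G e) - g (head G e)) * (f (tail G e) - f (head G e)) / len e)"
    by (intro sum.cong refl) (simp add: algebra_simps diff_divide_distrib add_divide_distrib)
  finally show ?thesis .
qed

text \<open>The current through \<open>e\<close> leaves its tail and enters its head, so restoring
  \<open>e\<close> adds a dipole whose strength is that current.\<close>

lemma net_outflow_del_arc:
  fixes G :: "('v::finite, 'e) pre_digraph"
  assumes "finite (arcs G)" "e \<in> arcs G"
  shows "net_outflow G len f x = net_outflow (pre_digraph.del_arc G e) len f x +
    (f (tail G e) - f (head G e)) / len e *
      (of_bool (x = tail G e) - of_bool (x = head G e))"
proof -
  have *: "(\<Sum>d | d \<in> arcs G \<and> t d = x. F d) =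
      (\<Sum>d | d \<in> arcs G \<and> d \<noteq> e \<and> t d = x. F d) + of_bool (x = t e) * F e"
    for t :: "'e \<Rightarrow> 'v" and F :: "'e \<Rightarrow> real"
  proof (cases "t e = x")
    case True
    then have "{d. d \<in> arcs G \<and> t d = x} = insert e {d. d \<in> arcs G \<and> d \<noteq> e \<and> t d = x}"
      using assms(2) by auto
    then show ?thesis
      using True assms(1) by simp
  next
    case False
    then have "{d. d \<in> arcs G \<and> t d = x} = {d. d \<in> arcs G \<and> d \<noteq> e \<and> t d = x}"
      by auto
    then show ?thesis
      using False by simp
  qed
  show ?thesis
    unfolding net_outflow_def
    by (simp add: * pre_digraph.del_arc_simps conj_assoc of_bool_def diff_divide_distrib)
qed

section \<open>The discrete Laplacian of an optimal metrized graph\<close>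

text \<open>A locale, so that the results below also apply to the graph without \<open>e\<close>
  whenever that graph is connected.\<close>

locale optimal_metrized_graph = metrized_graph G len
  for G :: "('v::finite, 'e) pre_digraph" and len +
  assumes optimal: "optimal_vertex_set G"
begin

definition Q :: "'v \<Rightarrow> 'v \<Rightarrow> real" where
  "Q x y = pseudo_inverse (discrete_laplacian G len) $ x $ y"

lemma joins_commute: "joins G e x y \<longleftrightarrow> joins G e y x"
  by (auto simp: joins_def)

text \<open>Optimality leaves at most one term in the sum; this form replaces the definite
  description and can be regrouped.\<close>

lemma laplacian_offdiag_eq_sum:
  "laplacian_offdiag G len x y = - (\<Sum>e | joins G e x y. 1 / len e)"
proof (cases "\<exists>e. joins G e x y")
  case True
  then obtain e where e: "joins G e x y"
    by blast
  then have "{e. joins G e x y} = {e}" "(THE e. joins G e x y) = e"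
    using optimal unfolding optimal_vertex_set_def by blast+
  then show ?thesis
    using True by (simp add: laplacian_offdiag_def)
qed (simp add: laplacian_offdiag_def)

lemma laplacian_sym: "transpose (discrete_laplacian G len) = discrete_laplacian G len"
  by (simp add: transpose_def discrete_laplacian_def vec_eq_iff laplacian_offdiag_eq_sum
      joins_commute)

text \<open>The diagonal entry makes each row sum to zero, so the product becomes a sum of potential
  differences over neighbours, which is Ohm's law.\<close>

lemma laplacian_mult:
  "(discrete_laplacian G len *v f) $ x = net_outflow G len (($) f) x"
proof -
  have "(discrete_laplacian G len *v f) $ x = discrete_laplacian G len $ x $ x * f $ x
      + (\<Sum>s\<in>UNIV - {x}. discrete_laplacian G len $ x $ s * f $ s)"
    by (simp add: matrix_vector_mult_def sum.remove[of UNIV x])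
  also have "\<dots> = (\<Sum>s\<in>UNIV - {x}. - laplacian_offdiag G len x s * (f $ x - f $ s))"
    by (simp add: discrete_laplacian_def sum_distrib_right sum_distrib_left sum_negf
        algebra_simps sum_subtractf)
  also have "\<dots> = (\<Sum>s\<in>UNIV. - laplacian_offdiag G len x s * (f $ x - f $ s))"
    by (simp add: sum.remove[of UNIV x])
  also have "\<dots> = (\<Sum>s\<in>UNIV. \<Sum>e | joins G e x s. (f $ x - f $ s) / len e)"
    by (simp add: laplacian_offdiag_eq_sum sum_distrib_right)
  also have "\<dots> = (\<Sum>s\<in>UNIV.
      (\<Sum>e | e \<in> {e \<in> arcs G. tail G e = x} \<and> head G e = s. (f $ x - f $ (head G e)) / len e) +
      (\<Sum>e | e \<in> {e \<in> arcs G. head G e = x} \<and> tail G e = s. (f $ x - f $ (tail G e)) / len e))"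
  proof (intro sum.cong refl)
    fix s
    let ?A = "{e. e \<in> {e \<in> arcs G. tail G e = x} \<and> head G e = s}"
    let ?B = "{e. e \<in> {e \<in> arcs G. head G e = x} \<and> tail G e = s}"
    \<comment> \<open>An edge lying in both \<open>?A\<close> and \<open>?B\<close> would be a loop
      at \<open>x\<close>.\<close>
    have noloop: "tail G e \<noteq> head G e" if "e \<in> arcs G" for e
      using optimal that unfolding optimal_vertex_set_def joins_def by (metis insert_absorb2)
    have eq: "{e. joins G e x s} = ?A \<union> ?B"
      by (auto simp: joins_def doubleton_eq_iff)
    have "?A \<inter> ?B = {}"
      using noloop by auto
    then have "(\<Sum>e | joins G e x s. (f $ x - f $ s) / len e) =
        (\<Sum>e\<in>?A. (f $ x - f $ s) / len e) + (\<Sum>e\<in>?B. (f $ x - f $ s) / len e)"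
      unfolding eq by (intro sum.union_disjoint) auto
    then show "(\<Sum>e | joins G e x s. (f $ x - f $ s) / len e) =
        (\<Sum>e\<in>?A. (f $ x - f $ (head G e)) / len e) + (\<Sum>e\<in>?B. (f $ x - f $ (tail G e)) / len e)"
      by simp
  qed
  also have "\<dots> = net_outflow G len (($) f) x"
    using sum.group[of "{e \<in> arcs G. tail G e = x}" UNIV "head G"
        "\<lambda>e. (f $ x - f $ (head G e)) / len e"]
      sum.group[of "{e \<in> arcs G. head G e = x}" UNIV "tail G"
        "\<lambda>e. (f $ x - f $ (tail G e)) / len e"]
    by (simp add: net_outflow_def sum.distrib)
  finally show ?thesis .
qed

text \<open>The energy of \<open>f\<close> vanishes and its terms are nonnegative, so no edge
  carries a potential drop; connectedness does the rest. All uniqueness claims for potentials rest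
  on this.\<close>

lemma net_outflow_eq_0_imp_constant:
  assumes "\<And>x. net_outflow G len f x = 0"
  shows "f x = f y"
proof -
  have "(\<Sum>e\<in>arcs G. (f (tail G e) - f (head G e)) * (f (tail G e) - f (head G e)) / len e) = 0"
    by (subst energy_eq[symmetric]) (simp_all add: assms)
  then have "f (tail G e) = f (head G e)" if "e \<in> arcs G" for e
    using that len_pos by (subst (asm) sum_nonneg_eq_0_iff) (force simp: less_imp_le)+
  then show ?thesis
    using connected verts_UNIV
    by (auto simp: connected_iff_same_component intro: same_component_invariant)
qed

lemma laplacian_kernel:
  "discrete_laplacian G len *v f = 0 \<longleftrightarrow> (\<forall>x y. f $ x = f $ y)"
proof
  assume "discrete_laplacian G len *v f = 0"
  then have "net_outflow G len (($) f) x = 0" for x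
    by (metis laplacian_mult zero_index)
  then show "\<forall>x y. f $ x = f $ y"
    using net_outflow_eq_0_imp_constant by blast
next
  assume const: "\<forall>x y. f $ x = f $ y"
  have diff: "f $ x - f $ y = 0" for x y
    using const by (metis diff_self)
  show "discrete_laplacian G len *v f = 0"
    unfolding vec_eq_iff laplacian_mult net_outflow_def diff by simp
qed

section \<open>Potentials expressed by the pseudo inverse\<close>

lemmas Q_props = pseudo_inverse_kernel_constants[OF laplacian_sym laplacian_kernel]

lemma Q_sym: "Q x y = Q y x"
  using Q_props(4) by (simp add: Q_def transpose_def vec_eq_iff)

lemma Q_row_sum: "(\<Sum>y\<in>UNIV. Q x y) = 0"
  using Q_props(3) by (simp add: Q_def matrix_matrix_mult_def vec_eq_iff flip: sum_divide_distrib)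

text \<open>A column of \<open>Q\<close> is the potential when unit current enters at
  \<open>y\<close> and is drained evenly from all vertices. The drain cancels in differences of
  columns, which are therefore dipole potentials.\<close>

lemma net_outflow_Q:
  "net_outflow G len (\<lambda>x. Q x y) x = of_bool (x = y) - 1 / real CARD('v)"
proof -
  have "net_outflow G len (\<lambda>x. Q x y) x =
      (discrete_laplacian G len *v (\<chi> x. Q x y)) $ x"
    unfolding laplacian_mult by (simp add: net_outflow_def)
  also have "\<dots> = (discrete_laplacian G len ** pseudo_inverse (discrete_laplacian G len)) $ x $ y"
    by (simp add: matrix_vector_mult_def matrix_matrix_mult_def Q_def)
  finally show ?thesis
    by (simp add: Q_props(1) mat_def)
qed

text \<open>Self-adjointness moves the net outflow from \<open>f\<close> onto \<open>Q\<close>,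
  where it is the identity minus averaging.\<close>

lemma sum_Q_net_outflow:
  "(\<Sum>x\<in>UNIV. Q y x * net_outflow G len f x) = f y - (\<Sum>x\<in>UNIV. f x) / real CARD('v)"
proof -
  have "(\<Sum>x\<in>UNIV. Q y x * net_outflow G len f x) =
      (\<Sum>x\<in>UNIV. f x * net_outflow G len (\<lambda>x. Q y x) x)"
    by (simp add: energy_eq mult.commute[of "Q y _ - Q y _"])
  also have "\<dots> = (\<Sum>x\<in>UNIV. f x * (of_bool (x = y) - 1 / real CARD('v)))"
    by (simp add: Q_sym[of y] net_outflow_Q)
  also have "\<dots> = f y - (\<Sum>x\<in>UNIV. f x) / real CARD('v)"
    by (simp add: right_diff_distrib sum_subtractf sum_divide_distrib)
  finally show ?thesis .
qed

text \<open>The dipole potential of \<open>y\<close> and \<open>z\<close>, shifted to vanish at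
  \<open>z\<close>, obeys Kirchhoff's law; two solutions differ by a constant, which the
  normalisation at \<open>z\<close> makes zero.\<close>

lemma voltage_eq_Q: "voltage G len z x y = Q x y - Q x z - Q z y + Q z z"
proof -
  define f where "f = (\<lambda>x. (Q x y - Q x z) - (Q z y - Q z z))"
  have "net_outflow G len (\<lambda>x. c) x = 0" for c x
    by (simp add: net_outflow_def)
  then have "net_outflow G len f x = of_bool (x = y) - of_bool (x = z)" for x
    unfolding f_def by (simp add: net_outflow_diff net_outflow_Q)
  then have f: "is_voltage_function G len z y f"
    by (simp add: is_voltage_function_def f_def)
  have "g = f" if g: "is_voltage_function G len z y g" for g
  proof
    fix x
    have "net_outflow G len (\<lambda>x. g x - f x) x = 0" for x
      using f g by (simp add: net_outflow_diff is_voltage_function_def)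
    then have "g x - f x = g z - f z"
      by (rule net_outflow_eq_0_imp_constant)
    then show "g x = f x"
      using f g by (simp add: is_voltage_function_def)
  qed
  then have "(THE g. is_voltage_function G len z y g) = f"
    using f by blast
  then show ?thesis
    by (simp add: voltage_def f_def)
qed

text \<open>Rows and columns of the Laplacian sum to zero, so only the cross terms of the expanded
  squares survive.\<close>

lemma laplacian_quadratic_form:
  "- 1 / 2 * (\<Sum>q\<in>UNIV. \<Sum>s\<in>UNIV. discrete_laplacian G len $ q $ s * (d q - d s)\<^sup>2) =
    (\<Sum>x\<in>UNIV. d x * net_outflow G len d x)"
proof -
  let ?L = "\<lambda>q s. discrete_laplacian G len $ q $ s"
  have sym: "?L q s = ?L s q" for q s
    using laplacian_sym by (simp add: transpose_def vec_eq_iff)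
  have row: "(\<Sum>s\<in>UNIV. ?L q s) = 0" for q
  proof -
    have "(discrete_laplacian G len *v 1) $ q = 0"
      by (subst laplacian_mult) (simp add: net_outflow_def)
    then show ?thesis
      by (simp add: matrix_vector_mult_def)
  qed
  have 1: "(\<Sum>q\<in>UNIV. \<Sum>s\<in>UNIV. ?L q s * (d q)\<^sup>2) = 0"
    by (simp add: row flip: sum_distrib_right)
  then have 2: "(\<Sum>q\<in>UNIV. \<Sum>s\<in>UNIV. ?L q s * (d s)\<^sup>2) = 0"
    by (subst sum.swap) (simp add: sym)
  have "(\<Sum>q\<in>UNIV. \<Sum>s\<in>UNIV. ?L q s * (d q - d s)\<^sup>2) =
      (\<Sum>q\<in>UNIV. \<Sum>s\<in>UNIV. ?L q s * (d q)\<^sup>2) + (\<Sum>q\<in>UNIV. \<Sum>s\<in>UNIV. ?L q s * (d s)\<^sup>2)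
      - 2 * (\<Sum>q\<in>UNIV. \<Sum>s\<in>UNIV. d q * (?L q s * d s))"
    by (simp add: power2_diff sum_distrib_left flip: sum.distrib sum_subtractf)
      (simp add: algebra_simps)
  moreover have "(\<Sum>s\<in>UNIV. ?L q s * d s) = net_outflow G len d q" for q
    using laplacian_mult[of "\<chi> x. d x" q]
    by (simp add: matrix_vector_mult_def net_outflow_def)
  ultimately show ?thesis
    by (simp add: 1 2 flip: sum_distrib_left)
qed

lemma dipole_potential:
  assumes "\<And>x. net_outflow G len f x = c * (of_bool (x = a) - of_bool (x = b))"
  shows "f x - f y = c * ((Q x a - Q x b) - (Q y a - Q y b))"
proof -
  have "net_outflow G len (\<lambda>x. f x - c * (Q x a - Q x b)) x = 0" for x
    by (simp add: net_outflow_diff net_outflow_scale net_outflow_Q assms)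
  then have "f x - c * (Q x a - Q x b) = f y - c * (Q y a - Q y b)"
    by (rule net_outflow_eq_0_imp_constant)
  then show ?thesis
    by (simp add: algebra_simps)
qed

section \<open>The contribution of an edge\<close>

text \<open>The potential \<open>g\<close>, equal to \<open>len e\<close> on the tail side and 0 on
  the other, drives unit current through \<open>e\<close> and none elsewhere, so it is the dipole
  potential up to a constant.\<close>

lemma bridge_term:
  assumes e: "e \<in> arcs G"
    and disconnected: "\<not> Digraph_Component.connected (pre_digraph.del_arc G e)"
  shows "(2 * (Q p (tail G e) - Q p (head G e)) - Q (tail G e) (tail G e)
    + Q (head G e) (head G e))\<^sup>2 = (len e)\<^sup>2"
proof -
  let ?a = "tail G e" and ?b = "head G e"
  define H where "H = pre_digraph.del_arc G e"
  have H: "verts H = UNIV" "arcs H = arcs G - {e}" "tail H = tail G" "head H = head G"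
    by (simp_all add: H_def pre_digraph.del_arc_simps verts_UNIV)
  define g where "g x = len e * of_bool (same_component H x ?a)" for x
  have inv: "g (tail G d) = g (head G d)" if "d \<in> arcs H" for d
  proof -
    have "same_component H (tail H d) (head H d)"
      by (rule same_component_arc[OF H(1) that])
    then have "same_component H (tail G d) ?a \<longleftrightarrow> same_component H (head G d) ?a"
      unfolding H by (blast intro: same_component_trans same_component_sym)
    then show ?thesis
      by (simp add: g_def)
  qed
  have ga: "g ?a = len e"
    by (simp add: g_def same_component_refl H)
  have gb: "g ?b = 0"
  proof (rule ccontr)
    \<comment> \<open>Then \<open>g\<close> would agree across every edge of \<open>G\<close>, hence
      be constant, and all vertices would lie in one component of \<open>H\<close>.\<close>
    assume "g ?b \<noteq> 0"
    then have "g ?b = g ?a"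
      by (auto simp: g_def same_component_refl H split: if_splits)
    then have "g (tail G d) = g (head G d)" if "d \<in> arcs G" for d
      using inv that by (cases "d = e") (simp_all add: H)
    then have "g x = g ?a" for x
      using connected verts_UNIV
      by (auto simp: connected_iff_same_component intro: same_component_invariant)
    then have comp: "same_component H x ?a" for x
      using ga len_pos[OF e] unfolding g_def
      by (metis less_irrefl mult_zero_right of_bool_eq(1))
    have "Digraph_Component.connected H"
      unfolding connected_iff_same_component[OF H(1)]
      using same_component_trans[OF comp same_component_sym[OF comp]] by blast
    then show False
      using disconnected by (simp add: H_def)
  qed
  have "net_outflow H len g x = 0" for x
    unfolding net_outflow_def 
    by (rule trans[OF arg_cong2[where f = "(+)", OF sum.neutral sum.neutral]])
      (use inv H in auto)
  then have "net_outflow G len g x = 1 * (of_bool (x = ?a) - of_bool (x = ?b))" for x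
    using len_pos[OF e] by (simp add: net_outflow_del_arc[OF finite_arcs e] ga gb flip: H_def)
  note dp = dipole_potential[OF this]
  have "2 * (Q p ?a - Q p ?b) - Q ?a ?a + Q ?b ?b = (g p - g ?a) + (g p - g ?b)"
    unfolding dp by (simp add: Q_sym[of ?b ?a])
  \<comment> \<open>One of the two differences is zero and the other is \<open>len e\<close> up to
    sign, depending on the side containing \<open>p\<close>.\<close>
  also have "\<dots>\<^sup>2 = (len e)\<^sup>2"
    unfolding ga gb by (simp add: g_def power2_eq_square)
  finally show ?thesis .
qed

text \<open>For a bridge both sides are \<open>len e\<close>. Otherwise the unit dipole potential
  \<open>f\<close> of \<open>H\<close> is in \<open>G\<close> a dipole potential of strength
  \<open>1 + R / len e\<close>, and this factor cancels against the denominator.\<close>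

lemma edge_term_eq:
  assumes e: "e \<in> arcs G"
  shows "edge_term G len p e = (2 * (Q p (tail G e) - Q p (head G e))
    - Q (tail G e) (tail G e) + Q (head G e) (head G e))\<^sup>2 / len e"
proof -
  let ?a = "tail G e" and ?b = "head G e"
  define H where "H = pre_digraph.del_arc G e"
  have H: "verts H = UNIV" "arcs H = arcs G - {e}" "tail H = tail G" "head H = head G"
    by (simp_all add: H_def pre_digraph.del_arc_simps verts_UNIV)
  have L: "0 < len e"
    by (rule len_pos[OF e])
  show ?thesis
  proof (cases "Digraph_Component.connected H")
    case False
    then show ?thesis
      using L bridge_term[OF e, of p]
      by (simp add: edge_term_def edge_R_def Let_def H_def power2_eq_square)
  next
    case True
    interpret H: fin_digraph H
      unfolding H_def by (rule fin_digraph_del_arc)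
    interpret H: optimal_metrized_graph H len
    proof unfold_locales
      show "optimal_vertex_set H"
        using optimal unfolding optimal_vertex_set_def joins_def H by blast
    qed (simp_all add: H True len_pos)
    define f where "f x = H.Q x ?a - H.Q x ?b" for x
    define R where "R = f ?a - f ?b"
    have fout: "net_outflow H len f x = of_bool (x = ?a) - of_bool (x = ?b)" for x
      unfolding f_def by (simp add: net_outflow_diff H.net_outflow_Q)
    \<comment> \<open>As an energy, \<open>R\<close> is nonnegative, so \<open>len e + R\<close> is
      nonzero when it is cancelled below.\<close>
    have "R = (\<Sum>x\<in>UNIV. f x * net_outflow H len f x)"
      by (simp add: fout R_def right_diff_distrib sum_subtractf)
    also have "\<dots> \<ge> 0"
      by (subst energy_eq) (auto intro!: sum_nonneg divide_nonneg_nonneg simp: H len_pos less_imp_le)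
    finally have R: "R \<ge> 0" .
    have "net_outflow G len f x = (1 + R / len e) * (of_bool (x = ?a) - of_bool (x = ?b))" for x
      by (simp add: net_outflow_del_arc[OF finite_arcs e] fout R_def algebra_simps flip: H_def)
    note dp = dipole_potential[OF this]
    have "edge_R G len e = ereal R"
      using True by (simp add: edge_R_def effective_resistance_def Let_def H.voltage_eq_Q
          f_def R_def H.Q_sym[of ?b ?a] flip: H_def)
    moreover have "edge_Ra G len e p = ereal (f ?a - f p)"
      using True by (simp add: edge_Ra_def Let_def H.voltage_eq_Q f_def flip: H_def)
    \<comment> \<open>Here current enters at \<open>p\<close>; reciprocity, the symmetry of
      \<open>H.Q\<close>, turns \<open>p\<close> into the point of measurement.\<close>
    moreover have "edge_Rb G len e p = ereal (f p - f ?b)"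
      using True by (simp add: edge_Rb_def Let_def H.voltage_eq_Q f_def H.Q_sym flip: H_def)
    ultimately have "edge_term G len p e =
        len e * ((f p - f ?a) + (f p - f ?b))\<^sup>2 / (len e + R)\<^sup>2"
      by (simp add: edge_term_def algebra_simps)
    also have "(f p - f ?a) + (f p - f ?b) = (1 + R / len e) *
        (2 * (Q p ?a - Q p ?b) - Q ?a ?a + Q ?b ?b)"
      unfolding dp by (simp add: Q_sym[of ?b ?a] algebra_simps)
    also have "1 + R / len e = (len e + R) / len e"
      using L by (simp add: field_simps)
    also have "len e * ((len e + R) / len e * D)\<^sup>2 / (len e + R)\<^sup>2 = D\<^sup>2 / len e" for D
      using L R by (simp add: power_mult_distrib power_divide power2_eq_square)
    finally show ?thesis .
  qed
qed

text \<open>The sum is the Dirichlet energy of \<open>D\<close>. On expansion the two terms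
  \<open>2 * d p\<close> cancel, and the two averaging terms each contribute \<open>2 / ?v\<close>
  times the trace, which removes the dependence on \<open>p\<close>.\<close>

lemma sum_edge_term:
  "(\<Sum>e\<in>arcs G. edge_term G len p e) =
    4 / real CARD('v) * (\<Sum>x\<in>UNIV. Q x x)
    + (\<Sum>x\<in>UNIV. Q x x * net_outflow G len (\<lambda>x. Q x x) x)"
proof -
  define d where "d = (\<lambda>x. Q x x)"
  define D where "D = (\<lambda>x. 2 * Q x p - d x)"
  let ?v = "real CARD('v)" and ?N = "net_outflow G len"
  have ND: "?N D x = 2 * (of_bool (x = p) - 1 / ?v) - ?N d x" for x
    unfolding D_def by (simp add: net_outflow_diff net_outflow_scale net_outflow_Q)
  have Q_column_sum: "(\<Sum>x\<in>UNIV. Q x p) = 0"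
    using Q_row_sum[of p] by (simp only: Q_sym[of _ p])
  have "(\<Sum>e\<in>arcs G. edge_term G len p e) =
      (\<Sum>e\<in>arcs G. (D (tail G e) - D (head G e)) * (D (tail G e) - D (head G e)) / len e)"
    by (intro sum.cong refl)
      (simp add: edge_term_eq D_def d_def Q_sym[of p] power2_eq_square algebra_simps)
  also have "\<dots> = (\<Sum>x\<in>UNIV. D x * ?N D x)"
    by (simp add: energy_eq)
  also have "\<dots> = 2 * (\<Sum>x\<in>UNIV. D x * of_bool (x = p)) - 2 / ?v * (\<Sum>x\<in>UNIV. D x)
      - 2 * (\<Sum>x\<in>UNIV. Q p x * ?N d x) + (\<Sum>x\<in>UNIV. d x * ?N d x)"
    unfolding ND sum_distrib_left sum_subtractf[symmetric] sum.distrib[symmetric]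
    by (intro sum.cong refl) (simp add: D_def Q_sym algebra_simps)
  \<comment> \<open>The columns of \<open>Q\<close> sum to zero, so only the diagonal part of
    \<open>D\<close> counts.\<close>
  also have "(\<Sum>x\<in>UNIV. D x) = - (\<Sum>x\<in>UNIV. d x)"
    by (simp add: D_def sum_subtractf Q_column_sum flip: sum_distrib_left)
  also have "(\<Sum>x\<in>UNIV. D x * of_bool (x = p)) = d p"
    by (simp add: D_def d_def)
  finally show ?thesis
    by (simp add: sum_Q_net_outflow d_def algebra_simps)
qed

end

theorem theorem4p8:
  fixes G :: "('v::finite, 'e) pre_digraph" and len :: "'e \<Rightarrow> real" and p :: 'v
  assumes "metrized_graph G len"
    and "optimal_vertex_set G"
  shows "(\<Sum>e\<in>arcs G. edge_term G len p e) =
      4 / real CARD('v) * trace (pseudo_inverse (discrete_laplacian G len))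
      - 1 / 2 * (\<Sum>q\<in>UNIV. \<Sum>s\<in>UNIV. discrete_laplacian G len $ q $ s *
          (pseudo_inverse (discrete_laplacian G len) $ q $ q
           - pseudo_inverse (discrete_laplacian G len) $ s $ s)\<^sup>2)"
proof -
  interpret optimal_metrized_graph G len
    using assms by (simp add: optimal_metrized_graph_def optimal_metrized_graph_axioms_def)
  show ?thesis
    using sum_edge_term[of p] laplacian_quadratic_form[of "\<lambda>x. Q x x"]
    by (simp add: Q_def trace_def)
qed

end
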